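(* Let $m,n$ be positive integers with $m<n$, let $\mathcal{Q}(A)\in\mathbb{R}^{m\times n}$ and $\mathcal{Q}(y)\in\mathbb{R}^m$ be given, and let $\Delta_A>0$, $\Delta_y>0$. Consider the following two optimization problems over nonnegative vectors $x\in\mathbb{R}^n$ (i.e. $x_i\ge 0$ for all $i=1,\dots,n$). (P) Minimize $\|x\|_1$ over all $x\in\mathbb{R}^n$, $x\succeq 0$, for which there exist $A\in\mathbb{R}^{m\times n}$, $y\in\mathbb{R}^m$, $\delta_A\in\mathbb{R}^{m\times n}$, $\delta_y\in\mathbb{R}^m$ such that $$y=Ax,\quad \mathcal{Q}(y)=y+\delta_y,\quad \mathcal{Q}(A)=A+\delta_A,\quad \|\delta_y\|_\infty\le\Delta_y,\quad \|\delta_A\|_\infty\le\Delta_A .$$ (LP) Minimize $\|x\|_1$ over all $x\in\mathbb{R}^n$, $x\succeq 0$, such that $Cx\preceq c$, where $$C=\begin{pmatrix}\mathcal{Q}(A)-\Delta_A\mathbf{1}_m\mathbf{1}_n^T\\ -\mathcal{Q}(A)-\Delta_A\mathbf{1}_m\mathbf{1}_n^T\end{pmatrix}\in\mathbb{R}^{2m\times n},\qquad c=\begin{pmatrix}\mathcal{Q}(y)+\Delta_y\mathbf{1}_m\\ -\mathcal{Q}(y)+\Delta_y\mathbf{1}_m\end{pmatrix}\in\mathbb{R}^{2m}.$$ Then (P) and (LP) are equivalent: a vector $x\succeq 0$ is feasible for (P) if and only if it is feasible for (LP), so that the two problems (which have the same objective) have the same optimal value and the same minimizers.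
   Context: For $a,b\in\mathbb{R}^d$, $a\preceq b$ (equivalently $b\succeq a$) means $a_i\le b_i$ for every $i$. $\mathbf{1}_d=(1,\dots,1)^T\in\mathbb{R}^d$. $\|x\|_1=\sum_i|x_i|$. For a vector $v$, $\|v\|_\infty=\max_i|v_i|$; for a matrix $M$, $\|M\|_\infty=\max_{i,j}|M_{ij}|$ denotes the entrywise maximum norm. $\mathcal{Q}(A)$ and $\mathcal{Q}(y)$ are the (known) quantized versions of an unknown matrix $A$ and an unknown vector $y$, and are simply treated as given data. *)

theory Defs
  imports "HOL-Analysis.Analysis"
begin

definition norm1 :: "real ^ 'n \<Rightarrow> real" where
  "norm1 x = (\<Sum>i\<in>UNIV. \<bar>x $ i\<bar>)"

text \<open>The order \<open>\<le>\<close> on \<open>real ^ 'n\<close> is componentwise, the constant \<open>1\<close> is the all-ones vector,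
  and \<open>infnorm\<close> is the largest absolute value of an entry, for vectors and for matrices alike
  (the standard basis of \<open>real ^ 'n ^ 'm\<close> consists of the matrix units).\<close>

definition P_feasible ::
    "real ^ 'n ^ 'm \<Rightarrow> real ^ 'm \<Rightarrow> real \<Rightarrow> real \<Rightarrow> (real ^ 'n) set" where
  "P_feasible QA Qy \<Delta>A \<Delta>y =
     {x. 0 \<le> x \<and>
         (\<exists>(A :: real ^ 'n ^ 'm) (y :: real ^ 'm) (\<delta>A :: real ^ 'n ^ 'm) (\<delta>y :: real ^ 'm).
            y = A *v x \<and> Qy = y + \<delta>y \<and> QA = A + \<delta>A \<and>
            infnorm \<delta>y \<le> \<Delta>y \<and> infnorm \<delta>A \<le> \<Delta>A)}"

definition ones_matrix :: "real ^ 'n ^ 'm" where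
  "ones_matrix = (columnvector (1 :: real ^ 'm) :: real ^ 1 ^ 'm)
                   ** (rowvector (1 :: real ^ 'n) :: real ^ 'n ^ 1)"

text \<open>The \<open>2m\<close> rows of a stacked vector or matrix are indexed by \<open>'m + 'm\<close>:
  \<open>Inl\<close> for the upper block, \<open>Inr\<close> for the lower one.\<close>

definition stack :: "'a ^ 'm \<Rightarrow> 'a ^ 'm \<Rightarrow> 'a ^ ('m + 'm)" where
  "stack u v = (\<chi> k. case k of Inl i \<Rightarrow> u $ i | Inr i \<Rightarrow> v $ i)"

definition LP_matrix :: "real ^ 'n ^ 'm \<Rightarrow> real \<Rightarrow> real ^ 'n ^ ('m + 'm)" where
  "LP_matrix QA \<Delta>A = stack (QA - \<Delta>A *\<^sub>R ones_matrix) (- QA - \<Delta>A *\<^sub>R ones_matrix)"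

definition LP_vector :: "real ^ 'm \<Rightarrow> real \<Rightarrow> real ^ ('m + 'm)" where
  "LP_vector Qy \<Delta>y = stack (Qy + \<Delta>y *\<^sub>R 1) (- Qy + \<Delta>y *\<^sub>R 1)"

definition LP_feasible ::
    "real ^ 'n ^ 'm \<Rightarrow> real ^ 'm \<Rightarrow> real \<Rightarrow> real \<Rightarrow> (real ^ 'n) set" where
  "LP_feasible QA Qy \<Delta>A \<Delta>y = {x. 0 \<le> x \<and> LP_matrix QA \<Delta>A *v x \<le> LP_vector Qy \<Delta>y}"

text \<open>The optimal value is extended real: it is \<open>\<infinity>\<close> when there is no feasible point.\<close>

definition optimal_value :: "('a \<Rightarrow> real) \<Rightarrow> 'a set \<Rightarrow> ereal" where
  "optimal_value f S = (INF x\<in>S. ereal (f x))"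

definition minimizers :: "('a \<Rightarrow> real) \<Rightarrow> 'a set \<Rightarrow> 'a set" where
  "minimizers f S = {x. is_arg_min f (\<lambda>z. z \<in> S) x}"

end

theory Submission
  imports Defs
begin

text \<open>
  For a fixed \<open>x \<ge> 0\<close> with entry sum \<open>s\<close>, both feasibility conditions say that every entry of the
  residual \<open>r = Qy - QA *v x\<close> satisfies \<open>\<bar>r $ i\<bar> \<le> \<Delta>y + \<Delta>A * s\<close>.

  For the linear programme this is the pair of inequalities in the rows \<open>Inl i\<close> and \<open>Inr i\<close>: since
  the all-ones matrix sends \<open>x\<close> to the constant vector \<open>s\<close>, they bound \<open>-r $ i\<close> and \<open>r $ i\<close>
  from above (\<open>LP_feasible_iff_residual\<close>).

  For the quantization problem, eliminating \<open>A\<close> and \<open>y\<close> turns the constraints into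
  \<open>r = \<delta>y - \<delta>A *v x\<close> with entrywise bounded errors (\<open>P_feasible_iff_errors\<close>). As \<open>x \<ge> 0\<close>, the
  triangle inequality gives the bound on \<open>r\<close>. Conversely the bound is attained row by row: when
  every error in row \<open>i\<close> is the same fraction \<open>t\<close> of its allowed maximum, with \<open>-t\<close> for the
  matrix entries, the right-hand side equals \<open>t * (\<Delta>y + \<Delta>A * s)\<close>, and this fills the whole range
  as \<open>t\<close> runs through \<open>[-1, 1]\<close> (\<open>P_feasible_iff_residual\<close>).

  The two feasible sets are therefore equal, and with them the optimal values and the minimizers.
\<close>

lemma infnorm_le_iff_Basis:
  fixes v :: "'a :: euclidean_space"
  shows "infnorm v \<le> c \<longleftrightarrow> (\<forall>b\<in>Basis. \<bar>v \<bullet> b\<bar> \<le> c)"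
  unfolding infnorm_Max by (subst Max_le_iff) auto

lemma infnorm_le_iff_vec:
  fixes v :: "real ^ 'n"
  shows "infnorm v \<le> c \<longleftrightarrow> (\<forall>i. \<bar>v $ i\<bar> \<le> c)"
  by (auto simp: infnorm_le_iff_Basis Basis_vec_def inner_axis)

lemma infnorm_le_iff_matrix:
  fixes M :: "real ^ 'n ^ 'm"
  shows "infnorm M \<le> c \<longleftrightarrow> (\<forall>i j. \<bar>M $ i $ j\<bar> \<le> c)"
  by (auto simp: infnorm_le_iff_Basis Basis_vec_def inner_axis)

lemma ones_matrix_nth: "(ones_matrix :: real ^ 'n ^ 'm) $ i $ j = 1"
  by (simp add: ones_matrix_def matrix_matrix_mult_def columnvector_def rowvector_def)

lemma ones_matrix_mult_nth: "((ones_matrix :: real ^ 'n ^ 'm) *v x) $ i = (\<Sum>j\<in>UNIV. x $ j)"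
  by (simp add: matrix_vector_mult_def ones_matrix_nth)

lemma stack_mult: "stack M N *v x = stack (M *v x) (N *v x)"
  by (simp add: vec_eq_iff stack_def matrix_vector_mult_def split: sum.split)

lemma stack_le_stack_iff: "stack u v \<le> stack u' v' \<longleftrightarrow> u \<le> u' \<and> v \<le> v'"
  by (auto simp: less_eq_vec_def stack_def split: sum.split)

lemma LP_feasible_iff_residual:
  fixes QA :: "real ^ 'n ^ 'm" and Qy :: "real ^ 'm"
  shows "x \<in> LP_feasible QA Qy \<Delta>A \<Delta>y \<longleftrightarrow>
           0 \<le> x \<and> (\<forall>i. \<bar>(Qy - QA *v x) $ i\<bar> \<le> \<Delta>y + \<Delta>A * (\<Sum>j\<in>UNIV. x $ j))"
proof -
  have neg: "(- QA) *v x = - (QA *v x)"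
    by (simp add: vec_eq_iff matrix_vector_mult_def sum_negf)
  show ?thesis
    unfolding LP_feasible_def LP_matrix_def LP_vector_def mem_Collect_eq
      stack_mult stack_le_stack_iff
    by (auto simp: matrix_vector_mult_diff_rdistrib scaleR_matrix_vector_assoc[symmetric] neg
        less_eq_vec_def ones_matrix_mult_nth abs_le_iff algebra_simps)
qed

lemma P_feasible_iff_errors:
  fixes QA :: "real ^ 'n ^ 'm" and Qy :: "real ^ 'm"
  shows "x \<in> P_feasible QA Qy \<Delta>A \<Delta>y \<longleftrightarrow>
           0 \<le> x \<and> (\<exists>(\<delta>A :: real ^ 'n ^ 'm) (\<delta>y :: real ^ 'm).
             Qy - QA *v x = \<delta>y - \<delta>A *v x \<and>
             (\<forall>i. \<bar>\<delta>y $ i\<bar> \<le> \<Delta>y) \<and> (\<forall>i j. \<bar>\<delta>A $ i $ j\<bar> \<le> \<Delta>A))"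
    (is "_ \<longleftrightarrow> 0 \<le> x \<and> ?errors")
proof
  assume "x \<in> P_feasible QA Qy \<Delta>A \<Delta>y"
  then obtain A \<delta>A \<delta>y where "0 \<le> x" "Qy = A *v x + \<delta>y" "QA = A + \<delta>A"
    "infnorm \<delta>y \<le> \<Delta>y" "infnorm \<delta>A \<le> \<Delta>A"
    unfolding P_feasible_def by blast
  moreover from this have "Qy - QA *v x = \<delta>y - \<delta>A *v x"
    by (simp add: matrix_vector_mult_add_rdistrib)
  ultimately show "0 \<le> x \<and> ?errors"
    unfolding infnorm_le_iff_vec infnorm_le_iff_matrix by blast
next
  assume "0 \<le> x \<and> ?errors"
  then obtain \<delta>A \<delta>y where *: "0 \<le> x" "Qy - QA *v x = \<delta>y - \<delta>A *v x"
    "infnorm \<delta>y \<le> \<Delta>y" "infnorm \<delta>A \<le> \<Delta>A"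
    unfolding infnorm_le_iff_vec infnorm_le_iff_matrix by blast
  then have "Qy = (QA - \<delta>A) *v x + \<delta>y"
    by (simp add: matrix_vector_mult_diff_rdistrib algebra_simps)
  moreover have "QA = (QA - \<delta>A) + \<delta>A"
    by simp
  ultimately show "x \<in> P_feasible QA Qy \<Delta>A \<Delta>y"
    unfolding P_feasible_def using * by blast
qed

text \<open>
  The triangle inequality is sharp here because \<open>x \<ge> 0\<close>: entries of \<open>\<delta>A\<close> of one common sign in
  a row contribute to \<open>(\<delta>A *v x) $ i\<close> without cancellation. The rows of \<open>\<delta>A\<close> are chosen
  independently of each other, so all residual bounds can be met at once. The condition
  \<open>\<Delta>y > 0\<close> makes the right-hand side positive even for \<open>x = 0\<close>, so that it can serve as a
  divisor.
\<close>

lemma P_feasible_iff_residual: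
  fixes QA :: "real ^ 'n ^ 'm" and Qy :: "real ^ 'm"
  assumes "\<Delta>A \<ge> 0" and "\<Delta>y > 0"
  shows "x \<in> P_feasible QA Qy \<Delta>A \<Delta>y \<longleftrightarrow>
           0 \<le> x \<and> (\<forall>i. \<bar>(Qy - QA *v x) $ i\<bar> \<le> \<Delta>y + \<Delta>A * (\<Sum>j\<in>UNIV. x $ j))"
    (is "_ \<longleftrightarrow> 0 \<le> x \<and> (\<forall>i. \<bar>?r $ i\<bar> \<le> ?R)")
proof
  assume "x \<in> P_feasible QA Qy \<Delta>A \<Delta>y"
  then obtain \<delta>A :: "real ^ 'n ^ 'm" and \<delta>y where x: "0 \<le> x" and r: "?r = \<delta>y - \<delta>A *v x"
    and y: "\<And>i. \<bar>\<delta>y $ i\<bar> \<le> \<Delta>y" and A: "\<And>i j. \<bar>\<delta>A $ i $ j\<bar> \<le> \<Delta>A"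
    unfolding P_feasible_iff_errors by blast
  have "\<bar>?r $ i\<bar> \<le> ?R" for i
  proof -
    have "\<bar>(\<delta>A *v x) $ i\<bar> \<le> (\<Sum>j\<in>UNIV. \<bar>\<delta>A $ i $ j * x $ j\<bar>)"
      unfolding matrix_vector_mult_def by (simp add: sum_abs)
    also have "\<dots> \<le> (\<Sum>j\<in>UNIV. \<Delta>A * x $ j)"
      using x A by (intro sum_mono) (simp add: abs_mult less_eq_vec_def mult_right_mono)
    finally show ?thesis
      using y[of i] unfolding r by (simp add: sum_distrib_left)
  qed
  with x show "0 \<le> x \<and> (\<forall>i. \<bar>?r $ i\<bar> \<le> ?R)"
    by blast
next
  assume *: "0 \<le> x \<and> (\<forall>i. \<bar>?r $ i\<bar> \<le> ?R)"
  then have "?R > 0"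
    using assms by (intro add_pos_nonneg mult_nonneg_nonneg sum_nonneg)
      (auto simp: less_eq_vec_def)
  \<comment> \<open>the fraction of the maximal error that row \<open>i\<close> uses; the opposite signs in \<open>\<delta>y\<close> and \<open>\<delta>A\<close>
    make both terms of \<open>\<delta>y - \<delta>A *v x\<close> push the residual in the same direction\<close>
  define t where "t i = ?r $ i / ?R" for i
  have t: "\<bar>t i\<bar> \<le> 1" for i
    using * \<open>?R > 0\<close> by (simp add: t_def)
  define \<delta>y :: "real ^ 'm" where "\<delta>y = (\<chi> i. t i * \<Delta>y)"
  define \<delta>A :: "real ^ 'n ^ 'm" where "\<delta>A = (\<chi> i j. - t i * \<Delta>A)"
  have "?r = \<delta>y - \<delta>A *v x"
  proof (unfold vec_eq_iff, intro allI)
    fix i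
    have "(\<delta>y - \<delta>A *v x) $ i = t i * ?R"
      by (simp add: \<delta>y_def \<delta>A_def matrix_vector_mult_def sum_distrib_left sum_negf algebra_simps)
    also have "\<dots> = ?r $ i"
      using \<open>?R > 0\<close> by (simp add: t_def)
    finally show "?r $ i = (\<delta>y - \<delta>A *v x) $ i" ..
  qed
  moreover have "\<bar>\<delta>y $ i\<bar> \<le> \<Delta>y" for i
    using t[of i] assms by (simp add: \<delta>y_def abs_mult mult_left_le_one_le)
  moreover have "\<bar>\<delta>A $ i $ j\<bar> \<le> \<Delta>A" for i j
    using t[of i] assms by (simp add: \<delta>A_def abs_mult mult_left_le_one_le)
  ultimately show "x \<in> P_feasible QA Qy \<Delta>A \<Delta>y"
    unfolding P_feasible_iff_errors using * by blast
qed

theorem mainTheorem1: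
  fixes QA :: "real ^ 'n ^ 'm" and Qy :: "real ^ 'm" and \<Delta>A \<Delta>y :: real
  assumes "CARD('m) < CARD('n)" and "\<Delta>A > 0" and "\<Delta>y > 0"
  shows "(\<forall>x :: real ^ 'n. 0 \<le> x \<longrightarrow>
             (x \<in> P_feasible QA Qy \<Delta>A \<Delta>y \<longleftrightarrow> x \<in> LP_feasible QA Qy \<Delta>A \<Delta>y)) \<and>
         optimal_value norm1 (P_feasible QA Qy \<Delta>A \<Delta>y)
           = optimal_value norm1 (LP_feasible QA Qy \<Delta>A \<Delta>y) \<and>
         minimizers norm1 (P_feasible QA Qy \<Delta>A \<Delta>y)
           = minimizers norm1 (LP_feasible QA Qy \<Delta>A \<Delta>y)"
proof -
  have "P_feasible QA Qy \<Delta>A \<Delta>y = LP_feasible QA Qy \<Delta>A \<Delta>y"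
    using assms by (intro set_eqI) (simp add: P_feasible_iff_residual LP_feasible_iff_residual)
  then show ?thesis
    by simp
qed

end
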